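(* Let $d,n\in\mathbb{N}$ and let $\mathfrak{m}(d)=\{m_{j_1,\dots,j_{d+1}}\}_{j_1,\dots,j_{d+1}=1}^n$ be a multi-dimensional real matrix all of whose entries are non-negative. Let $X_1,\dots,X_d$ be real random $n\times n$ matrices, write $X^{(k)}_{ij}$ for the $(i,j)$ entry of $X_k$, and suppose that the $n^2d$ entries $X^{(k)}_{ij}$ are mutually independent. Let $f_{ijk}\in\mathcal{B}$ and suppose $X^{(k)}_{ij}\in\mathcal{T}(f_{ijk})$ for all $i,j\in\{1,\dots,n\}$, $k\in\{1,\dots,d\}$. Let $\widetilde{X}_k=\{\widetilde{X}^{(k)}_{ij}\}_{i,j=1}^n$, $k=1,\dots,d$, be the random matrices with mutually independent entries $\widetilde{X}^{(k)}_{ij}(s)=\sup f_{ijk}^{-1}[1-s,1]$, $s\in(0,1)$. Then for all $t\ge0$, $$P\Big(\operatorname{Tr}\big(\mathfrak{M}_{\mathfrak{m}(d)}(X_1,\dots,X_d)\big)\ge t\Big)\le P\Big(\operatorname{Tr}\big(\mathfrak{M}_{\mathfrak{m}(d)}(\widetilde{X}_1,\dots,\widetilde{X}_d)\big)\ge t\Big),$$ and the right-hand side cannot be improved, i.e. for each $t\ge0$ (with $\mathfrak{m}(d)$ and the $f_{ijk}$ fixed) no smaller number is an upper bound of the left-hand side valid for all real random $n\times n$ matrices $X_1,\dots,X_d$ whose $n^2d$ entries $X^{(k)}_{ij}$ are mutually independent and satisfy $X^{(k)}_{ij}\in\mathcal{T}(f_{ijk})$ for all $i,j\in\{1,\dots,n\}$,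 $k\in\{1,\dots,d\}$.
   Context: The $d$-linear Schur multiplier with symbol $\mathfrak{m}(d)$ is the map on $d$-tuples of real $n\times n$ matrices $X_k=(x^{(k)}_{ij})_{i,j=1}^n$ given by $$\mathfrak{M}_{\mathfrak{m}(d)}(X_1,\dots,X_d)=\sum_{j_1,\dots,j_{d+1}=1}^n m_{j_1,\dots,j_{d+1}}\,x^{(1)}_{j_1,j_2}\cdots x^{(d)}_{j_d,j_{d+1}}\,E_{j_1,j_{d+1}},$$ where $E_{i,j}$ is the elementary matrix whose only non-zero entry is a $1$ in position $(i,j)$. Random matrices are substituted into this formula entrywise. A real random variable is neat if it is a monotonically increasing (nondecreasing) function $X:(0,1)\to\mathbb{R}$, where $(0,1)$ carries Lebesgue measure on the Borel $\sigma$-algebra. $\mathcal{B}$ is the set of functions $f:[0,\infty)\to[0,1]$ with $f(0)=1$, $f$ nonincreasing with limit $0$ at $\infty$, and $f$ left continuous; such $f$ is extended by $f(t)=1$ for $t<0$. For $f\in\mathcal{B}$, $\mathcal{T}(f)$ is the set of neat random variables $X$ with $P(|X|\ge t)\le f(t)$ for all $t\ge0$. A mutually independent family of neat random variables is understood as a product random variable: for $N$ neat random variables $Y_1,\dots,Y_N$, it is the map $(0,1)^N\to\mathbb{R}^N$, $(s_1,\dots,s_N)\mapsto(Y_1(s_1),\dots,Y_N(s_N))$, with Lebesgue measure on $(0,1)^N$; here $N=n^2d$. *)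

theory Defs
  imports "HOL-Probability.Probability"
begin

text \<open>Square matrices of size n are elements of \<^typ>\<open>real^'n^'n\<close> with \<open>n = CARD('n)\<close>.
  A multi-index \<open>(j\<^sub>1, \<dots>, j\<^bsub>d+1\<^esub>)\<close> is an extensional function on \<open>{1..d+1}\<close>.\<close>

definition multi_indices :: "nat \<Rightarrow> (nat \<Rightarrow> 'n) set" where
  "multi_indices d = {1..d+1} \<rightarrow>\<^sub>E UNIV"

definition elem_mat :: "'n::finite \<Rightarrow> 'n \<Rightarrow> real^'n^'n" where
  "elem_mat i j = (\<chi> a b. if a = i \<and> b = j then 1 else 0)"

definition schur_multiplier ::
  "nat \<Rightarrow> ((nat \<Rightarrow> 'n) \<Rightarrow> real) \<Rightarrow> (nat \<Rightarrow> real^'n^'n) \<Rightarrow> real^'n^'n::finite" where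
  "schur_multiplier d m X =
     (\<Sum>j\<in>multi_indices d.
        (m j * (\<Prod>k=1..d. X k $ j k $ j (k+1))) *\<^sub>R elem_mat (j 1) (j (d+1)))"

definition unit_space :: "real measure" where
  "unit_space = restrict_space lborel {0<..<1}"

definition neat :: "(real \<Rightarrow> real) \<Rightarrow> bool" where
  "neat X \<longleftrightarrow> mono_on {0<..<1} X"

text \<open>Members of \<open>tail_class\<close> are functions on \<open>[0,\<infinity>)\<close>; their values at negative reals are
  irrelevant, and \<open>extend_tail\<close> performs the extension by 1.\<close>

definition tail_class :: "(real \<Rightarrow> real) set" where
  "tail_class = {f. f \<in> {0..} \<rightarrow> {0..1} \<and> f 0 = 1 \<and> antimono_on {0..} f \<and>
     (f \<longlongrightarrow> 0) at_top \<and> (\<forall>t>0. continuous (at_left t) f)}"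

definition extend_tail :: "(real \<Rightarrow> real) \<Rightarrow> real \<Rightarrow> real" where
  "extend_tail f t = (if t < 0 then 1 else f t)"

definition tail_bounded :: "(real \<Rightarrow> real) \<Rightarrow> (real \<Rightarrow> real) set" where
  "tail_bounded f = {X. neat X \<and> (\<forall>t\<ge>0. \<P>(s in unit_space. \<bar>X s\<bar> \<ge> t) \<le> f t)}"

definition extremal_rv :: "(real \<Rightarrow> real) \<Rightarrow> real \<Rightarrow> real" where
  "extremal_rv f s = Sup (extend_tail f -` {1-s..1})"

text \<open>Independence of neat random variables is realised on the product space with one
  coordinate \<open>(k, i, j)\<close> for each entry \<open>X k i j\<close>, the \<open>(i, j)\<close> entry of the \<open>k\<close>-th matrix.\<close>

definition entry_space :: "nat \<Rightarrow> (nat \<times> 'n \<times> 'n \<Rightarrow> real) measure" where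
  "entry_space d = (\<Pi>\<^sub>M e\<in>{1..d} \<times> UNIV \<times> UNIV. unit_space)"

definition indep_matrices ::
  "(nat \<Rightarrow> 'n \<Rightarrow> 'n \<Rightarrow> real \<Rightarrow> real) \<Rightarrow> (nat \<times> 'n \<times> 'n \<Rightarrow> real) \<Rightarrow> nat \<Rightarrow> real^'n^'n::finite" where
  "indep_matrices X s k = (\<chi> i j. X k i j (s (k, i, j)))"

definition trace_tail ::
  "nat \<Rightarrow> ((nat \<Rightarrow> 'n::finite) \<Rightarrow> real) \<Rightarrow> (nat \<Rightarrow> 'n \<Rightarrow> 'n \<Rightarrow> real \<Rightarrow> real) \<Rightarrow> real \<Rightarrow> real" where
  "trace_tail d m X t =
     \<P>(s in entry_space d. trace (schur_multiplier d m (indep_matrices X s)) \<ge> t)"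

end

theory Submission
  imports Defs
begin

text \<open>Replacing every entry by its absolute value can only increase the trace, which is a polynomial
  with non-negative coefficients in the entries. The law of \<open>\<bar>X\<bar>\<close> has a nondecreasing
  representation on \<open>(0,1)\<close>, its quantile function \<open>Y\<close>, and every nondecreasing \<open>Y\<close> with tail bounded by
  \<open>f\<close> lies pointwise below the extremal variable: \<open>P(\<bar>Y\<bar> \<ge> Y s) \<ge> 1 - s\<close> forces \<open>f (Y s) \<ge> 1 - s\<close>.
  The comparison of the traces is therefore pointwise on the product space once \<open>\<bar>X\<bar>\<close> is exchanged for
  \<open>Y\<close> in every coordinate. The extremal variables are themselves admissible, so the bound is attained.\<close>

section \<open>Lebesgue measure on the unit interval\<close>

lemma space_unit_space [simp]: "space unit_space = {0<..<1}"
  by (simp add: unit_space_def space_restrict_space)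

lemma sets_unit_space: "sets unit_space = sets (restrict_space borel {0<..<1})"
  by (simp add: unit_space_def sets_restrict_space)

interpretation unit_space: prob_space unit_space
  by (auto simp: unit_space_def emeasure_restrict_space space_restrict_space intro!: prob_spaceI)

lemma measure_unit_space_atLeast:
  assumes "0 \<le> a" "a \<le> 1"
  shows "measure unit_space {s\<in>{0<..<1}. a \<le> s} = 1 - a"
proof -
  have "measure unit_space {s\<in>{0<..<1}. a \<le> s} = measure lborel {s\<in>{0<..<1}. a \<le> s}"
    unfolding unit_space_def by (subst measure_restrict_space) auto
  also have "\<dots> = measure lborel {a<..<1}"
    unfolding measure_def
  proof (rule arg_cong[where f = enn2real], rule emeasure_eq_AE)
    \<comment> \<open>The two sets differ at most in the point \<open>a\<close>, which is
      null.\<close>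
    show "AE s in lborel. s \<in> {s\<in>{0<..<1}. a \<le> s} \<longleftrightarrow> s \<in> {a<..<1}"
      using AE_lborel_singleton[of a] by eventually_elim (use assms in auto)
  qed auto
  finally show ?thesis
    using assms by simp
qed

lemma neat_measurable:
  assumes "neat X"
  shows "X \<in> borel_measurable unit_space"
proof -
  have "X \<in> borel_measurable (restrict_space borel {0<..<1})"
    using assms unfolding neat_def by (rule borel_measurable_mono_on_fnc)
  then show ?thesis
    by (simp cong: measurable_cong_sets add: sets_unit_space)
qed

section \<open>The extremal variable as a generalised inverse of the tail bound\<close>

lemma extend_tail_superlevel:
  assumes f: "f \<in> tail_class" and s: "0 < s" "s < 1"
  shows "bdd_above (extend_tail f -` {1-s..1})"
    and "0 \<in> extend_tail f -` {1-s..1}"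
proof -
  \<comment> \<open>The supremum in \<open>extremal_rv\<close> is meaningful only for a non-empty
    set bounded above. It is bounded because \<open>f\<close> tends to 0 while
    \<open>1 - s > 0\<close>; it contains 0 because \<open>f 0 = 1\<close>.\<close>
  have "(f \<longlongrightarrow> 0) at_top"
    using f by (simp add: tail_class_def)
  then have "\<forall>\<^sub>F t in at_top. f t < 1 - s"
    using s by (intro order_tendstoD) auto
  then obtain B where B: "\<And>t. t \<ge> B \<Longrightarrow> f t < 1 - s"
    by (auto simp: eventually_at_top_linorder)
  show "bdd_above (extend_tail f -` {1-s..1})"
  proof (rule bdd_aboveI)
    fix t assume "t \<in> extend_tail f -` {1-s..1}"
    \<comment> \<open>Negative reals all lie in the set, since the extension is 1 there; the 0 in
      \<open>max 0 B\<close> covers them.\<close>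
    then show "t \<le> max 0 B"
      using B[of t] by (cases "t < 0"; cases "B \<le> t") (auto simp: extend_tail_def)
  qed
  show "0 \<in> extend_tail f -` {1-s..1}"
    using f s by (auto simp: tail_class_def extend_tail_def)
qed

lemma le_extremal_rv:
  assumes f: "f \<in> tail_class" and s: "0 < s" "s < 1" and t: "0 \<le> t" "1 - s \<le> f t"
  shows "t \<le> extremal_rv f s"
proof -
  have "f t \<le> 1"
    using f t by (auto simp: tail_class_def Pi_iff)
  then have "t \<in> extend_tail f -` {1-s..1}"
    using t by (auto simp: extend_tail_def)
  then show ?thesis
    unfolding extremal_rv_def by (intro cSup_upper extend_tail_superlevel f s)
qed

lemma extremal_rv_nonneg:
  assumes "f \<in> tail_class" "0 < s" "s < 1"
  shows "0 \<le> extremal_rv f s"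
  using assms by (intro le_extremal_rv) (auto simp: tail_class_def)

text \<open>A Galois connection between \<open>f\<close> and its generalised inverse. Left
  continuity of \<open>f\<close> makes the supremum attained, which is the content of the forward
  direction.\<close>

lemma extremal_rv_ge_iff:
  assumes f: "f \<in> tail_class" and s: "0 < s" "s < 1" and t: "0 \<le> t"
  shows "t \<le> extremal_rv f s \<longleftrightarrow> 1 - s \<le> f t"
proof
  assume le: "t \<le> extremal_rv f s"
  show "1 - s \<le> f t"
  \<comment> \<open>Left continuity is available at positive \<open>t\<close> only; at 0 the value
    \<open>f 0 = 1\<close> suffices.\<close>
  proof (cases "t = 0")
    case True
    then show ?thesis
      using f s by (simp add: tail_class_def)
  next
    case False
    with t have "t > 0" by simp
    \<comment> \<open>Each \<open>u\<close> in \<open>(0,t)\<close> is strictly below the supremum,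
      hence below some \<open>v\<close> of the superlevel set, and \<open>f\<close> is
      nonincreasing. The limit from the left then reaches \<open>t\<close> itself.\<close>
    have "\<forall>\<^sub>F u in at_left t. 1 - s \<le> f u"
      using eventually_at_left_real[OF \<open>t > 0\<close>]
    proof eventually_elim
      case (elim u)
      then have "u < Sup (extend_tail f -` {1-s..1})"
        using le by (simp add: extremal_rv_def)
      then obtain v where v: "v \<in> extend_tail f -` {1-s..1}" "u < v"
        using less_cSup_iff extend_tail_superlevel[OF f s] by (metis empty_iff)
      moreover have "f v \<le> f u"
        using f elim v by (auto simp: tail_class_def monotone_on_def)
      ultimately show ?case
        using elim by (auto simp: extend_tail_def)
    qed
    moreover have "(f \<longlongrightarrow> f t) (at_left t)"
      using f \<open>t > 0\<close> by (simp add: tail_class_def continuous_within)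
    ultimately show ?thesis
      by (intro tendsto_lowerbound[of f _ "at_left t"]) auto
  qed
qed (use assms in \<open>auto intro: le_extremal_rv\<close>)

lemma extremal_rv_neat:
  assumes "f \<in> tail_class"
  shows "neat (extremal_rv f)"
  unfolding neat_def
proof (rule mono_onI)
  fix r s :: real
  assume rs: "r \<in> {0<..<1}" "s \<in> {0<..<1}" "r \<le> s"
  show "extremal_rv f r \<le> extremal_rv f s"
  proof (rule le_extremal_rv)
    show "0 \<le> extremal_rv f r"
      using rs assms by (simp add: extremal_rv_nonneg)
    \<comment> \<open>The supremum is attained, so \<open>extremal_rv f r\<close> lies in its own
      superlevel set, and a fortiori in the larger one for \<open>s\<close>.\<close>
    then have "1 - r \<le> f (extremal_rv f r)"
      using rs assms extremal_rv_ge_iff[of f r "extremal_rv f r"] by simp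
    then show "1 - s \<le> f (extremal_rv f r)"
      using rs by simp
  qed (use rs assms in auto)
qed

text \<open>By the Galois connection the event consists of all \<open>s\<close> from
  \<open>1 - f t\<close> on and has measure exactly \<open>f t\<close>, so the tail bound holds with
  equality.\<close>

lemma extremal_rv_in_tail_bounded:
  assumes f: "f \<in> tail_class"
  shows "extremal_rv f \<in> tail_bounded f"
proof -
  have "measure unit_space {s\<in>{0<..<1}. \<bar>extremal_rv f s\<bar> \<ge> t} \<le> f t" if t: "t \<ge> 0" for t
  proof -
    have "{s\<in>{0<..<1}. \<bar>extremal_rv f s\<bar> \<ge> t} = {s\<in>{0<..<1}. 1 - f t \<le> s}"
      using extremal_rv_ge_iff[OF f _ _ t] extremal_rv_nonneg[OF f] by fastforce
    moreover have "0 \<le> f t" "f t \<le> 1"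
      using f t by (auto simp: tail_class_def Pi_iff)
    ultimately show ?thesis
      using measure_unit_space_atLeast[of "1 - f t"] by simp
  qed
  then show ?thesis
    by (simp add: tail_bounded_def extremal_rv_neat[OF f])
qed

text \<open>Monotonicity gives \<open>X u \<ge> X s\<close> on \<open>u \<ge> s\<close>, a set of
  measure \<open>1 - s\<close>. The bound is one-sided: near 0 a neat variable may be very negative
  while the extremal one is small, so \<open>\<bar>X\<bar>\<close> needs a nondecreasing copy before
  it can be compared.\<close>

lemma tail_bounded_le_extremal_rv:
  assumes f: "f \<in> tail_class" and X: "X \<in> tail_bounded f" and s: "0 < s" "s < 1"
  shows "X s \<le> extremal_rv f s"
proof (cases "X s \<ge> 0")
  case True
  have [measurable]: "X \<in> borel_measurable unit_space"
    using X by (intro neat_measurable) (simp add: tail_bounded_def)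
  have "1 - s = measure unit_space {u\<in>{0<..<1}. s \<le> u}"
    using s by (subst measure_unit_space_atLeast) auto
  also have "\<dots> \<le> measure unit_space {u\<in>space unit_space. \<bar>X u\<bar> \<ge> X s}"
  proof (rule unit_space.finite_measure_mono)
    show "{u\<in>{0<..<1}. s \<le> u} \<subseteq> {u\<in>space unit_space. \<bar>X u\<bar> \<ge> X s}"
      using X s by (force simp: tail_bounded_def neat_def monotone_on_def)
  qed measurable
  also have "\<dots> \<le> f (X s)"
    using X True by (simp add: tail_bounded_def)
  finally show ?thesis
    using True by (intro le_extremal_rv f s)
next
  case False
  then show ?thesis
    using extremal_rv_nonneg[OF f s] by linarith
qed

section \<open>Quantile representation of a non-negative variable\<close>

lemma nonneg_neat_representation:
  assumes "Z \<in> borel_measurable unit_space" and nonneg: "\<And>s. s \<in> {0<..<1} \<Longrightarrow> 0 \<le> Z s"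
  obtains Y where "neat Y" "\<And>s. s \<in> {0<..<1} \<Longrightarrow> 0 \<le> Y s"
    "distr unit_space borel Y = distr unit_space borel Z"
proof -
  note [measurable] = assms(1)
  let ?\<mu> = "distr unit_space borel Z"
  interpret real_distribution ?\<mu>
    using unit_space.prob_space_distr[OF assms(1)]
    by (simp add: real_distribution_def real_distribution_axioms_def)
  interpret cdf_distribution ?\<mu> ..
  \<comment> \<open>\<open>I\<close> is the quantile function of the law of \<open>Z\<close>. At a
    negative value \<open>I s\<close> the cdf would vanish, yet it is at least \<open>s > 0\<close>
    there.\<close>
  have "0 \<le> I s" if "s \<in> {0<..<1}" for s
  proof (rule ccontr)
    assume "\<not> 0 \<le> I s"
    then have "Z -` {..I s} \<inter> space unit_space = {}"
      using nonneg by fastforce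
    then have "cdf ?\<mu> (I s) = 0"
      by (simp add: cdf_def measure_distr)
    then show False
      using pseudoinverse[of s "I s"] that by simp
  qed
  moreover have "neat I"
    unfolding neat_def by (rule mono_I)
  moreover have "distr unit_space borel I = ?\<mu>"
    using distr_I_eq_M by (simp add: unit_space_def)
  ultimately show ?thesis
    using that by blast
qed

section \<open>Coordinatewise images of product measures\<close>

lemma measurable_PiM_coordinatewise:
  assumes "\<And>i. i \<in> I \<Longrightarrow> f i \<in> measurable (M i) (N i)"
  shows "(\<lambda>x. \<lambda>i\<in>I. f i (x i)) \<in> measurable (PiM I M) (PiM I N)"
proof (rule measurable_restrict)
  fix i assume i: "i \<in> I"
  show "(\<lambda>x. f i (x i)) \<in> measurable (PiM I M) (N i)"
    by (rule measurable_compose[where g = "f i"], rule measurable_component_singleton[OF i],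
        rule assms[OF i])
qed

text \<open>It suffices to compare the measures on boxes: the preimage of a box is a box, and its
  measure factorises.\<close>

lemma distr_PiM_coordinatewise:
  assumes "finite I"
    and M: "\<And>i. i \<in> I \<Longrightarrow> prob_space (M i)"
    and f: "\<And>i. i \<in> I \<Longrightarrow> f i \<in> measurable (M i) (N i)"
  shows "distr (PiM I M) (PiM I N) (\<lambda>x. \<lambda>i\<in>I. f i (x i)) = PiM I (\<lambda>i. distr (M i) (N i) (f i))"
proof -
  \<comment> \<open>The locale \<open>product_prob_space\<close> asks for a probability measure at
    every index; a point mass fills the indices outside \<open>I\<close> without changing the
    products over \<open>I\<close>.\<close>
  define M' where "M' i = (if i \<in> I then M i else return (count_space UNIV) undefined)" for i
  define D where
    "D i = (if i \<in> I then distr (M i) (N i) (f i) else return (count_space UNIV) undefined)" for i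
  have "prob_space (M' i)" "prob_space (D i)" for i
    using M f by (auto simp: M'_def D_def intro: prob_space.prob_space_distr prob_space_return)
  then interpret M': product_prob_space M' + D: product_prob_space D
    by (auto intro!: product_prob_spaceI)
  have eq: "PiM I M = PiM I M'" "PiM I (\<lambda>i. distr (M i) (N i) (f i)) = PiM I D"
    by (auto simp: M'_def D_def intro: PiM_cong)
  have sets_D: "sets (D i) = sets (N i)" if "i \<in> I" for i
    using that by (simp add: D_def)
  have f' [measurable]: "f i \<in> measurable (M' i) (N i)" if "i \<in> I" for i
    using f that by (simp add: M'_def)
  have meas [measurable]: "(\<lambda>x. \<lambda>i\<in>I. f i (x i)) \<in> measurable (PiM I M') (PiM I N)"
    by (intro measurable_PiM_coordinatewise f')
  have "distr (PiM I M') (PiM I N) (\<lambda>x. \<lambda>i\<in>I. f i (x i)) = PiM I D"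
  proof (rule D.PiM_eqI[OF \<open>finite I\<close>])
    show "sets (distr (PiM I M') (PiM I N) (\<lambda>x. \<lambda>i\<in>I. f i (x i))) = sets (PiM I D)"
      using sets_PiM_cong[OF refl sets_D, of I] by simp
  next
    fix A assume "\<And>i. i \<in> I \<Longrightarrow> A i \<in> sets (D i)"
    then have A: "\<And>i. i \<in> I \<Longrightarrow> A i \<in> sets (N i)"
      using sets_D by blast
    have "emeasure (distr (PiM I M') (PiM I N) (\<lambda>x. \<lambda>i\<in>I. f i (x i))) (Pi\<^sub>E I A) =
        emeasure (PiM I M') (\<Pi>\<^sub>E i\<in>I. f i -` A i \<inter> space (M' i))"
      using A by (subst emeasure_distr)
        (auto intro!: sets_PiM_I_finite \<open>finite I\<close> arg_cong[where f = "emeasure (PiM I M')"]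
          simp: space_PiM PiE_iff)
    also have "\<dots> = (\<Prod>i\<in>I. emeasure (M' i) (f i -` A i \<inter> space (M' i)))"
      using A by (intro M'.emeasure_PiM \<open>finite I\<close> measurable_sets[OF f']) auto
    also have "\<dots> = (\<Prod>i\<in>I. emeasure (D i) (A i))"
      using A f by (intro prod.cong) (auto simp: D_def M'_def emeasure_distr)
    finally show "emeasure (distr (PiM I M') (PiM I N) (\<lambda>x. \<lambda>i\<in>I. f i (x i))) (Pi\<^sub>E I A) =
        (\<Prod>i\<in>I. emeasure (D i) (A i))" .
  qed
  then show ?thesis
    by (simp add: eq)
qed

section \<open>The trace as a polynomial in the entries\<close>

definition trace_poly ::
  "nat \<Rightarrow> ((nat \<Rightarrow> 'n::finite) \<Rightarrow> real) \<Rightarrow> (nat \<times> 'n \<times> 'n \<Rightarrow> real) \<Rightarrow> real" where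
  "trace_poly d m y =
     (\<Sum>j\<in>multi_indices d. of_bool (j 1 = j (d+1)) * (m j * (\<Prod>k=1..d. y (k, j k, j (k+1)))))"

lemma trace_elem_mat: "trace (elem_mat i j) = of_bool (i = j)"
  by (cases "i = j") (auto simp: trace_def elem_mat_def intro: sum.neutral)

text \<open>By linearity of the trace, only multi-indices with equal ends survive. As a function of
  the whole family of entries, the trace can be studied on product spaces.\<close>

lemma trace_schur_multiplier:
  "trace (schur_multiplier d m X) = trace_poly d m (\<lambda>(k, i, j). X k $ i $ j)"
proof -
  have "trace (schur_multiplier d m X) = (\<Sum>j\<in>multi_indices d.
      (m j * (\<Prod>k=1..d. X k $ j k $ j (k+1))) * trace (elem_mat (j 1) (j (d+1))))"
    unfolding schur_multiplier_def trace_def sum_component sum_distrib_left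
    by (subst sum.swap) simp
  then show ?thesis
    by (simp add: trace_elem_mat trace_poly_def mult.commute)
qed

text \<open>Products of ordered factors of arbitrary sign need not be ordered, hence the absolute
  values in the hypothesis: the product is first bounded by that of the absolute values.\<close>

lemma trace_poly_mono:
  assumes "\<forall>j\<in>multi_indices d. m j \<ge> 0"
    and "\<And>k i j. k \<in> {1..d} \<Longrightarrow> \<bar>x (k, i, j)\<bar> \<le> y (k, i, j)"
  shows "trace_poly d m x \<le> trace_poly d m y"
  unfolding trace_poly_def
proof (intro sum_mono mult_left_mono)
  fix j
  have "(\<Prod>k=1..d. x (k, j k, j (k+1))) \<le> (\<Prod>k=1..d. \<bar>x (k, j k, j (k+1))\<bar>)"
    by (rule order_trans[OF abs_ge_self]) (simp only: abs_prod order_refl)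
  also have "\<dots> \<le> (\<Prod>k=1..d. y (k, j k, j (k+1)))"
    using assms(2) by (intro prod_mono) auto
  finally show "(\<Prod>k=1..d. x (k, j k, j (k+1))) \<le> (\<Prod>k=1..d. y (k, j k, j (k+1)))" .
qed (use assms(1) in auto)

lemma trace_poly_measurable [measurable]:
  "trace_poly d m \<in> borel_measurable (PiM ({1..d} \<times> UNIV \<times> UNIV) (\<lambda>_. borel))"
  unfolding trace_poly_def
  by (intro borel_measurable_sum borel_measurable_times borel_measurable_prod
      borel_measurable_const measurable_component_singleton) auto

text \<open>Allows passing to families restricted to the index set, whose values elsewhere are
  \<open>undefined\<close>.\<close>

lemma trace_poly_cong:
  assumes "\<And>e. e \<in> {1..d} \<times> UNIV \<times> UNIV \<Longrightarrow> x e = y e"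
  shows "trace_poly d m x = trace_poly d m y"
  unfolding trace_poly_def using assms by (intro sum.cong prod.cong arg_cong2[where f = "(*)"]) auto

section \<open>Comparison of the trace tails\<close>

lemma prob_space_entry_space: "prob_space (entry_space d)"
  unfolding entry_space_def by (intro prob_space_PiM unit_space.prob_space_axioms)

lemma space_entry_space: "space (entry_space d) = ({1..d} \<times> UNIV \<times> UNIV \<rightarrow>\<^sub>E {0<..<1})"
  by (simp add: entry_space_def space_PiM)

text \<open>Pointwise domination makes the events nested. Monotonicity of the measure asks for
  measurability of the larger event, hence the assumption on \<open>Y\<close>.\<close>

lemma trace_tail_mono:
  assumes "\<forall>j\<in>multi_indices d. m j \<ge> 0"
    and "\<And>k i j. k \<in> {1..d} \<Longrightarrow> Y k i j \<in> borel_measurable unit_space"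
    and "\<And>k i j s. k \<in> {1..d} \<Longrightarrow> s \<in> {0<..<1} \<Longrightarrow> \<bar>X k i j s\<bar> \<le> Y k i j s"
  shows "trace_tail d m X t \<le> trace_tail d m Y t"
proof -
  let ?I = "{1..d} \<times> UNIV \<times> UNIV :: (nat \<times> 'a \<times> 'a) set"
  interpret prob_space "entry_space d :: (nat \<times> 'a \<times> 'a \<Rightarrow> real) measure"
    by (rule prob_space_entry_space)
  let ?p = "\<lambda>X s. trace (schur_multiplier d m (indep_matrices X s))"
  have p_eq: "?p X s = trace_poly d m (\<lambda>e\<in>?I. (case e of (k, i, j) \<Rightarrow> X k i j) (s e))"
    for X s
    unfolding trace_schur_multiplier
    by (rule trace_poly_cong) (auto simp: indep_matrices_def)
  have [measurable]: "(\<lambda>s. \<lambda>e\<in>?I. (case e of (k, i, j) \<Rightarrow> Y k i j) (s e))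
      \<in> measurable (entry_space d) (PiM ?I (\<lambda>_. borel))"
    unfolding entry_space_def using assms(2) by (intro measurable_PiM_coordinatewise) auto
  have [measurable]: "?p Y \<in> borel_measurable (entry_space d)"
    unfolding p_eq by measurable
  show ?thesis
    unfolding trace_tail_def
  proof (rule finite_measure_mono)
    have "?p X s \<le> ?p Y s" if "s \<in> space (entry_space d)" for s
      unfolding p_eq using that assms(3)
      by (intro trace_poly_mono assms(1)) (auto simp: space_entry_space PiE_iff)
    then show "{s\<in>space (entry_space d). t \<le> ?p X s} \<subseteq> {s\<in>space (entry_space d). t \<le> ?p Y s}"
      by force
  qed measurable
qed

text \<open>The tail depends on the entries only through their laws, so a variable may be exchanged
  for another with the same law.\<close>

lemma trace_tail_distr:
  assumes X: "\<And>k i j. k \<in> {1..d} \<Longrightarrow> X k i j \<in> borel_measurable unit_space"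
  shows "trace_tail d m X t =
    measure (PiM ({1..d} \<times> UNIV \<times> UNIV) (\<lambda>(k, i, j). distr unit_space borel (X k i j)))
      {y\<in>space (PiM ({1..d} \<times> UNIV \<times> UNIV) (\<lambda>_. borel)). t \<le> trace_poly d m y}"
proof -
  let ?I = "{1..d} \<times> UNIV \<times> UNIV :: (nat \<times> 'a \<times> 'a) set"
  let ?g = "\<lambda>e. case e of (k, i, j) \<Rightarrow> X k i j"
  let ?h = "\<lambda>s. \<lambda>e\<in>?I. ?g e (s e)"
  have g: "?g e \<in> borel_measurable unit_space" if "e \<in> ?I" for e
    using X that by auto
  have h: "?h \<in> measurable (entry_space d) (PiM ?I (\<lambda>_. borel))"
    unfolding entry_space_def
    by (intro measurable_PiM_coordinatewise g)
  have "trace (schur_multiplier d m (indep_matrices X s)) = trace_poly d m (?h s)" for s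
    unfolding trace_schur_multiplier
    by (rule trace_poly_cong) (auto simp: indep_matrices_def)
  then have "trace_tail d m X t = measure (distr (entry_space d) (PiM ?I (\<lambda>_. borel)) ?h)
      {y\<in>space (PiM ?I (\<lambda>_. borel)). t \<le> trace_poly d m y}"
    unfolding trace_tail_def using measurable_space[OF h]
    by (subst measure_distr[OF h]) (measurable, auto intro!: arg_cong[where f = "measure (entry_space d)"])
  also have "distr (entry_space d) (PiM ?I (\<lambda>_. borel)) ?h =
      PiM ?I (\<lambda>e. distr unit_space borel (?g e))"
    unfolding entry_space_def
    by (rule distr_PiM_coordinatewise) (use g unit_space.prob_space_axioms in auto)
  finally show ?thesis
    by (simp add: case_prod_unfold)
qed

lemma trace_tail_le_extremal:
  assumes m: "\<forall>j\<in>multi_indices d. m j \<ge> 0"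
    and f: "\<And>k i j. k \<in> {1..d} \<Longrightarrow> f i j k \<in> tail_class"
    and X: "\<And>k i j. k \<in> {1..d} \<Longrightarrow> X k i j \<in> tail_bounded (f i j k)"
  shows "trace_tail d m X t \<le> trace_tail d m (\<lambda>k i j. extremal_rv (f i j k)) t"
proof -
  have X_meas: "X k i j \<in> borel_measurable unit_space" if "k \<in> {1..d}" for k i j
    using X[OF that] by (intro neat_measurable) (simp add: tail_bounded_def)
  \<comment> \<open>\<open>Z\<close> need not be nondecreasing, so it is not compared with the
    extremal variable directly but through a neat \<open>Y\<close> of the same law.\<close>
  define Z where "Z k i j = (\<lambda>s. \<bar>X k i j s\<bar>)" for k i j
  have Z_meas: "Z k i j \<in> borel_measurable unit_space" if "k \<in> {1..d}" for k i j
    unfolding Z_def using X_meas[OF that] by measurable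
  have "\<exists>Y. neat Y \<and> (\<forall>s\<in>{0<..<1}. 0 \<le> Y s) \<and>
      distr unit_space borel Y = distr unit_space borel (Z k i j)" if "k \<in> {1..d}" for k i j
    by (rule nonneg_neat_representation[OF Z_meas[OF that]]) (auto simp: Z_def)
  then obtain Y where Y: "\<And>k i j. k \<in> {1..d} \<Longrightarrow> neat (Y k i j)"
    "\<And>k i j s. k \<in> {1..d} \<Longrightarrow> s \<in> {0<..<1} \<Longrightarrow> 0 \<le> Y k i j s"
    "\<And>k i j. k \<in> {1..d} \<Longrightarrow> distr unit_space borel (Y k i j) = distr unit_space borel (Z k i j)"
    by metis
  \<comment> \<open>\<open>Y\<close> is non-negative with the law of \<open>\<bar>X\<bar>\<close>,
    and the tail bound on \<open>X\<close> only sees \<open>\<bar>X\<bar>\<close>.\<close>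
  have Y_tail: "Y k i j \<in> tail_bounded (f i j k)" if k: "k \<in> {1..d}" for k i j
  proof -
    have "measure unit_space {s\<in>space unit_space. \<bar>Y k i j s\<bar> \<ge> t} \<le> f i j k t" if "t \<ge> 0" for t
    proof -
      have "measure unit_space {s\<in>space unit_space. \<bar>Y k i j s\<bar> \<ge> t} =
          measure (distr unit_space borel (Y k i j)) {t..}"
        using Y(2)[OF k] neat_measurable[OF Y(1)[OF k]]
        by (subst measure_distr) (auto intro!: arg_cong[where f = "measure unit_space"])
      also have "\<dots> = measure unit_space {s\<in>space unit_space. \<bar>X k i j s\<bar> \<ge> t}"
        unfolding Y(3)[OF k] using Z_meas[OF k]
        by (subst measure_distr)
          (auto simp: Z_def intro!: arg_cong[where f = "measure unit_space"])
      also have "\<dots> \<le> f i j k t"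
        using X[OF k] that by (simp add: tail_bounded_def)
      finally show ?thesis .
    qed
    then show ?thesis
      using Y(1)[OF k] by (simp add: tail_bounded_def)
  qed
  have "trace_tail d m X t \<le> trace_tail d m Z t"
    by (rule trace_tail_mono[OF m Z_meas]) (auto simp: Z_def)
  also have "\<dots> = trace_tail d m Y t"
  proof -
    \<comment> \<open>\<open>Y\<close> and \<open>Z\<close> are related in law only, so the equality
      goes through the product of the laws.\<close>
    have "PiM ({1..d} \<times> UNIV \<times> UNIV) (\<lambda>(k, i, j). distr unit_space borel (Z k i j)) =
        PiM ({1..d} \<times> UNIV \<times> UNIV) (\<lambda>(k, i, j). distr unit_space borel (Y k i j))"
      by (rule PiM_cong) (use Y(3) in auto)
    moreover have "Y k i j \<in> borel_measurable unit_space" if "k \<in> {1..d}" for k i j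
      by (intro neat_measurable Y(1) that)
    ultimately show ?thesis
      by (subst (1 2) trace_tail_distr) (simp_all add: Z_meas)
  qed
  also have "\<dots> \<le> trace_tail d m (\<lambda>k i j. extremal_rv (f i j k)) t"
  proof (rule trace_tail_mono[OF m])
    show "extremal_rv (f i j k) \<in> borel_measurable unit_space" if "k \<in> {1..d}" for k i j
      by (intro neat_measurable extremal_rv_neat f that)
    \<comment> \<open>Non-negativity of \<open>Y\<close> turns the one-sided bound into one on
      \<open>\<bar>Y\<bar>\<close>.\<close>
    show "\<bar>Y k i j s\<bar> \<le> extremal_rv (f i j k) s" if "k \<in> {1..d}" "s \<in> {0<..<1}" for k i j s
      using tail_bounded_le_extremal_rv[OF f Y_tail, of k s] Y(2) that by simp
  qed
  finally show ?thesis .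
qed

theorem theorem2p3p2:
  fixes d :: nat
    and m :: "(nat \<Rightarrow> 'n::finite) \<Rightarrow> real"
    and f :: "'n \<Rightarrow> 'n \<Rightarrow> nat \<Rightarrow> real \<Rightarrow> real"
  assumes "d \<ge> 1"
    and "\<forall>j\<in>multi_indices d. m j \<ge> 0"
    and "\<forall>i j. \<forall>k\<in>{1..d}. f i j k \<in> tail_class"
  shows "(\<forall>X. (\<forall>i j. \<forall>k\<in>{1..d}. X k i j \<in> tail_bounded (f i j k)) \<longrightarrow>
            (\<forall>t\<ge>0. trace_tail d m X t \<le> trace_tail d m (\<lambda>k i j. extremal_rv (f i j k)) t)) \<and>
         (\<forall>t\<ge>0. \<forall>c < trace_tail d m (\<lambda>k i j. extremal_rv (f i j k)) t.
            \<not> (\<forall>X. (\<forall>i j. \<forall>k\<in>{1..d}. X k i j \<in> tail_bounded (f i j k)) \<longrightarrow>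
                    trace_tail d m X t \<le> c))"
proof (intro conjI allI impI notI)
  fix X :: "nat \<Rightarrow> 'n \<Rightarrow> 'n \<Rightarrow> real \<Rightarrow> real" and t
  assume "\<forall>i j. \<forall>k\<in>{1..d}. X k i j \<in> tail_bounded (f i j k)"
  then show "trace_tail d m X t \<le> trace_tail d m (\<lambda>k i j. extremal_rv (f i j k)) t"
    using assms(3) by (intro trace_tail_le_extremal assms(2)) auto
next
  fix t c
  assume "c < trace_tail d m (\<lambda>k i j. extremal_rv (f i j k)) t"
    and bound: "\<forall>X. (\<forall>i j. \<forall>k\<in>{1..d}. X k i j \<in> tail_bounded (f i j k)) \<longrightarrow> trace_tail d m X t \<le> c"
  \<comment> \<open>The extremal family is admissible, so the supposed bound \<open>c\<close>
    applies to it.\<close>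
  moreover have "trace_tail d m (\<lambda>k i j. extremal_rv (f i j k)) t \<le> c"
    by (rule bound[rule_format]) (use assms(3) in \<open>auto intro: extremal_rv_in_tail_bounded\<close>)
  ultimately show False
    by simp
qed

end
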